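(* Let $n$ be a positive integer and let $a,b$ be integers with $0<a<b$, regarded as elements of $\mathbb{Z}_n$. Consider the multisets of elements of $\mathbb{Z}_n$ $$\mathcal{W}=\{0,a,b,2b,b+a,b-a,2b-a,2b-2a,3b-a,3b-2a,2b+a,3b\},$$ $$\mathcal{B}=\{0,a,b,2b,b+a,b-a,2b-a,2b-2a,3b-a,3b-2a,-a,b-2a\}.$$ Suppose all 12 elements of $\mathcal{W}$ are pairwise distinct in $\mathbb{Z}_n$, and all 12 elements of $\mathcal{B}$ are pairwise distinct in $\mathbb{Z}_n$. Then the cyclic Haar graph $H(n,\{0,a,b\})$ is splittable. More precisely, $$\Sigma=\{0^+,(2b)^+,(2b-2a)^+,(b-a)^-,(b+a)^-,(3b-a)^-\}$$ is a splitting set for $H(n,\{0,a,b\})$.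
   Context: For a positive integer $n$ and $S\subseteq\mathbb{Z}_n$, the cyclic Haar graph $H(n,S)$ has vertex set $\{i^+: i\in\mathbb{Z}_n\}\cup\{i^-: i\in\mathbb{Z}_n\}$. Its edges join $i^+$ to $(i+k)^-$ for each $i\in\mathbb{Z}_n$ and each $k\in S$. For a graph $G$, the square $G^2$ has the same vertex set, and two distinct vertices are adjacent in $G^2$ iff their distance in $G$ is at most 2. A connected graph $G$ is splittable if there is a set $\Sigma\subseteq V(G)$ that is independent in $G^2$ and such that $G-\Sigma$ is disconnected. Such a $\Sigma$ is called a splitting set.
   Formalization: "H is splittable" is asserted only when H is connected, since splittability is defined only for connected graphs and the hypotheses allow disconnected H (e.g. n=200, a=2, b=20); that Σ is a splitting set is proved in all cases. *)

theory Defs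
  imports "Graph_Theory.Graph_Theory"
begin

text \<open>
  Elements of Z/nZ are represented by their canonical representatives in \<open>{0..<int n}\<close>; an
  integer x is regarded as an element of Z/nZ through \<open>x mod int n\<close>.  The vertices \<open>i\<^sup>+\<close> and
  \<open>i\<^sup>-\<close> of a cyclic Haar graph are \<open>PlusV i\<close> and \<open>MinusV i\<close>.
  A simple graph is a symmetric loop-free digraph without parallel arcs (\<open>pair_graph\<close>).
\<close>

datatype haar_vertex = PlusV int | MinusV int

definition cyclic_haar :: "nat \<Rightarrow> int set \<Rightarrow> haar_vertex pair_pre_digraph" where
  "cyclic_haar n S =
    \<lparr> pverts = PlusV ` {0..<int n} \<union> MinusV ` {0..<int n},
      parcs = (\<Union>i\<in>{0..<int n}. \<Union>k\<in>S.
        {(PlusV i, MinusV ((i + k) mod int n)), (MinusV ((i + k) mod int n), PlusV i)}) \<rparr>"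

lemma pair_graph_cyclic_haar:
  assumes "n > 0" "S \<subseteq> {0..<int n}"
  shows "pair_graph (cyclic_haar n S)"
proof
  have "finite S" using assms(2) finite_subset by blast
  then show "finite (parcs (cyclic_haar n S))"
    by (auto simp: cyclic_haar_def)
  show "symmetric (with_proj (cyclic_haar n S))"
    by (auto simp: symmetric_def cyclic_haar_def intro!: symI)
qed (use assms in \<open>auto simp: cyclic_haar_def\<close>)

text \<open>Distance is the infimum of walk lengths (\<open>\<infinity>\<close> if there is no walk).\<close>

definition graph_dist :: "'a pair_pre_digraph \<Rightarrow> 'a \<Rightarrow> 'a \<Rightarrow> ereal" where
  "graph_dist G u v = wf_digraph.\<mu> (with_proj G) (\<lambda>_. 1) u v"

definition graph_square :: "'a pair_pre_digraph \<Rightarrow> 'a pair_pre_digraph" where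
  "graph_square G =
    \<lparr> pverts = pverts G,
      parcs = {(u, v). u \<in> pverts G \<and> v \<in> pverts G \<and> u \<noteq> v \<and> graph_dist G u v \<le> 2} \<rparr>"

definition independent_set :: "'a pair_pre_digraph \<Rightarrow> 'a set \<Rightarrow> bool" where
  "independent_set G A \<longleftrightarrow> A \<subseteq> pverts G \<and> (\<forall>u\<in>A. \<forall>v\<in>A. (u, v) \<notin> parcs G)"

text \<open>
  The library's \<open>connected\<close> is false for the null graph.  Non-emptiness is required here so
  that deleting all vertices does not count as disconnecting a graph (otherwise the
  one-vertex graph would be splittable).
\<close>

definition disconnected :: "('a, 'b) pre_digraph \<Rightarrow> bool" where
  "disconnected G \<longleftrightarrow> verts G \<noteq> {} \<and> \<not> connected G"

definition splitting_set :: "'a pair_pre_digraph \<Rightarrow> 'a set \<Rightarrow> bool" where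
  "splitting_set G A \<longleftrightarrow>
    independent_set (graph_square G) A \<and>
    disconnected (with_proj G \<restriction> (pverts G - A))"

definition splittable :: "'a pair_pre_digraph \<Rightarrow> bool" where
  "splittable G \<longleftrightarrow> connected (with_proj G) \<and> (\<exists>A. splitting_set G A)"

end

theory Submission
  imports Defs
begin

text \<open>
  The set \<open>\<Sigma>\<close> is the outer boundary of the hexagon
  \<open>b\<^sup>+ b\<^sup>- (b-a)\<^sup>+ (2b-a)\<^sup>- (2b-a)\<^sup>+ (2b)\<^sup>-\<close>, and the vertex \<open>a\<^sup>+\<close> lies outside the hexagon and \<open>\<Sigma>\<close>.
  The first (second) list consists of the neighbours of the plus (minus) vertices of \<open>\<Sigma>\<close>
  together with the minus (plus) vertices of \<open>\<Sigma>\<close>, so the two distinctness assumptions say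
  that no two vertices of \<open>\<Sigma>\<close> are adjacent or have a common neighbour.
\<close>

text \<open>The distance is an infimum, not assumed to be attained: being below 3, it yields an
  actual walk of cost below 3. Costs are lengths here, so that walk has at most two arcs.\<close>

lemma (in pair_wf_digraph) graph_dist_le_2D:
  assumes "graph_dist G u v \<le> 2"
  shows "u = v \<or> (u, v) \<in> parcs G \<or> (\<exists>w. (u, w) \<in> parcs G \<and> (w, v) \<in> parcs G)"
proof -
  have "(INF p\<in>{p. awalk u p v}. ereal (awalk_cost (\<lambda>_. 1) p)) < 3"
    using assms unfolding graph_dist_def \<mu>_def
    by (rule le_less_trans) simp
  then obtain p where p: "awalk u p v" and "ereal (awalk_cost (\<lambda>_. 1) p) < 3"
    by (auto simp: INF_less_iff)
  moreover have "awalk_cost (\<lambda>_. 1) p = length p"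
    by (simp add: awalk_cost_def sum_list_triv)
  ultimately have "length p < 3"
    by simp
  then consider "p = []" | e where "p = [e]" | e f where "p = [e, f]"
    \<comment> \<open>This rule serves only to split lists into length 0, length 1 and length at
      least 2.\<close>
    by (cases p rule: remdups_adj.cases) auto
  then show ?thesis
    using p by cases (auto simp: awalk_def)
qed

text \<open>\<open>connected\<close> means strong connectivity of the symmetric closure. The
  equivalence for arcs inside \<open>V\<close> keeps walks of the closure that start in
  \<open>C\<close> within \<open>C\<close>, in whichever direction they traverse arcs.\<close>

lemma disconnected_induce_subgraphI:
  assumes "x \<in> C" "x \<in> V" "y \<in> V" "y \<notin> C"
    and "\<And>u v. (u, v) \<in> parcs G \<Longrightarrow> u \<in> V \<Longrightarrow> v \<in> V \<Longrightarrow> u \<in> C \<longleftrightarrow> v \<in> C"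
  shows "disconnected (with_proj G \<restriction> V)"
proof -
  let ?K = "mk_symmetric (with_proj G \<restriction> V)"
  have "\<not> x \<rightarrow>\<^sup>*\<^bsub>?K\<^esub> y"
  proof
    assume "x \<rightarrow>\<^sup>*\<^bsub>?K\<^esub> y"
    then have "(x, y) \<in> (arcs_ends ?K)\<^sup>*"
      by (rule reachable_rtranclI)
    then have "y \<in> C"
    proof (induction rule: rtrancl_induct)
      case base
      show ?case by fact
    next
      case (step v w)
      then show ?case
        using assms(5) by (auto simp: mk_symmetric_def)
    qed
    with assms(4) show False by contradiction
  qed
  moreover have "x \<in> verts ?K" "y \<in> verts ?K"
    using assms(2,3) by (simp_all add: mk_symmetric_def)
  ultimately have "\<not> connected (with_proj G \<restriction> V)"
    unfolding connected_def by blast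
  then show ?thesis
    using assms(2) by (auto simp: disconnected_def)
qed

text \<open>Stated for arbitrary integer representatives, so that neighbourhoods can be computed by
  integer arithmetic.\<close>

lemma parcs_cyclic_haar_PlusV:
  assumes "n > 0"
  shows "(PlusV (x mod int n), v) \<in> parcs (cyclic_haar n ((\<lambda>k. k mod int n) ` S))
    \<longleftrightarrow> v \<in> (\<lambda>k. MinusV ((x + k) mod int n)) ` S"
  using assms by (auto simp: cyclic_haar_def mod_simps)

lemma parcs_cyclic_haar_MinusV:
  assumes "n > 0"
  shows "(MinusV (y mod int n), v) \<in> parcs (cyclic_haar n ((\<lambda>k. k mod int n) ` S))
    \<longleftrightarrow> v \<in> (\<lambda>k. PlusV ((y - k) mod int n)) ` S" (is "?L \<longleftrightarrow> ?R")
proof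
  assume ?L
  then obtain i k where "i \<in> {0..<int n}" "k \<in> S" "v = PlusV i"
    "y mod int n = (i + k) mod int n"
    by (auto simp: cyclic_haar_def mod_simps)
  moreover from this have "(y - k) mod int n = i"
    by (metis add_diff_cancel_right' atLeastLessThan_iff mod_diff_left_eq mod_pos_pos_trivial)
  ultimately show ?R by auto
next
  assume ?R
  then obtain k where "k \<in> S" "v = PlusV ((y - k) mod int n)" by auto
  then show ?L
    using assms by (force simp: cyclic_haar_def mod_simps)
qed

lemma parcs_cyclic_haar_sym:
  "(u, v) \<in> parcs (cyclic_haar n S) \<longleftrightarrow> (v, u) \<in> parcs (cyclic_haar n S)"
  by (auto simp: cyclic_haar_def)

theorem theorem6:
  fixes n :: nat and a b :: int
  assumes "n > 0" and "0 < a" and "a < b"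
    and "distinct (map (\<lambda>x. x mod int n)
      [0, a, b, 2*b, b + a, b - a, 2*b - a, 2*b - 2*a, 3*b - a, 3*b - 2*a, 2*b + a, 3*b])"
    and "distinct (map (\<lambda>x. x mod int n)
      [0, a, b, 2*b, b + a, b - a, 2*b - a, 2*b - 2*a, 3*b - a, 3*b - 2*a, - a, b - 2*a])"
  defines "H \<equiv> cyclic_haar n ((\<lambda>x. x mod int n) ` {0, a, b})"
  shows "splitting_set H
      ((\<lambda>x. PlusV (x mod int n)) ` {0, 2*b, 2*b - 2*a} \<union>
       (\<lambda>x. MinusV (x mod int n)) ` {b - a, b + a, 3*b - a}) \<and>
    (connected (with_proj H) \<longrightarrow> splittable H)"
proof -
  define p where "p x = PlusV (x mod int n)" for x
  define m where "m x = MinusV (x mod int n)" for x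
  define \<Sigma> where "\<Sigma> = {p 0, p (2*b), p (2*b - 2*a), m (b - a), m (b + a), m (3*b - a)}"
  define N where "N u = {v. (u, v) \<in> parcs H}" for u
  have \<Sigma>_eq: "(\<lambda>x. PlusV (x mod int n)) ` {0, 2*b, 2*b - 2*a} \<union>
      (\<lambda>x. MinusV (x mod int n)) ` {b - a, b + a, 3*b - a} = \<Sigma>"
    by (auto simp: \<Sigma>_def p_def m_def)
  have pm [simp]: "p x \<noteq> m y" "m y \<noteq> p x" for x y
    by (simp_all add: p_def m_def)
  have N_p: "N (p x) = {m x, m (x + a), m (x + b)}" for x
    unfolding N_def p_def m_def H_def parcs_cyclic_haar_PlusV[OF assms(1)] by auto
  have N_m: "N (m y) = {p y, p (y - a), p (y - b)}" for y
    unfolding N_def p_def m_def H_def parcs_cyclic_haar_MinusV[OF assms(1)] by auto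
  have W: "distinct (map m
      [0, a, b, 2*b, b + a, b - a, 2*b - a, 2*b - 2*a, 3*b - a, 3*b - 2*a, 2*b + a, 3*b])"
    using assms(4) unfolding m_def by simp
  have B: "distinct (map p
      [0, a, b, 2*b, b + a, b - a, 2*b - a, 2*b - 2*a, 3*b - a, 3*b - 2*a, - a, b - 2*a])"
    using assms(5) unfolding p_def by simp
  \<comment> \<open>Unfolding \<open>distinct\<close> gives each inequality in one orientation; the
    reversed lists supply the other.\<close>
  note [simp] = W[simplified] B[simplified]
    W[THEN distinct_rev[THEN iffD2], simplified] B[THEN distinct_rev[THEN iffD2], simplified]
  \<comment> \<open>In this block and the next, the first three vertices lie in \<Sigma> and the
    last three on the hexagon. Indices are normalised to the terms of \<open>W\<close> and
    \<open>B\<close>, so that the inequalities apply.\<close>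
  have N_plus:
    "N (p 0) = {m 0, m a, m b}"
    "N (p (2*b)) = {m (2*b), m (2*b + a), m (3*b)}"
    "N (p (2*b - 2*a)) = {m (2*b - 2*a), m (2*b - a), m (3*b - 2*a)}"
    "N (p b) = {m b, m (b + a), m (2*b)}"
    "N (p (b - a)) = {m (b - a), m b, m (2*b - a)}"
    "N (p (2*b - a)) = {m (2*b - a), m (2*b), m (3*b - a)}"
    unfolding N_p by (simp_all add: algebra_simps)
  have N_minus:
    "N (m (b - a)) = {p (b - a), p (b - 2*a), p (- a)}"
    "N (m (b + a)) = {p (b + a), p b, p a}"
    "N (m (3*b - a)) = {p (3*b - a), p (3*b - 2*a), p (2*b - a)}"
    "N (m b) = {p b, p (b - a), p 0}"
    "N (m (2*b)) = {p (2*b), p (2*b - a), p b}"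
    "N (m (2*b - a)) = {p (2*b - a), p (2*b - 2*a), p (b - a)}"
    unfolding N_m by (simp_all add: algebra_simps)

  have "pair_graph H"
    unfolding H_def using assms(1) by (intro pair_graph_cyclic_haar) auto
  then interpret pair_graph H .
  have pverts_H: "p x \<in> pverts H" "m x \<in> pverts H" for x
    using assms(1) by (auto simp: H_def cyclic_haar_def p_def m_def)
  have sym_H: "(u, v) \<in> parcs H \<longleftrightarrow> (v, u) \<in> parcs H" for u v
    unfolding H_def by (rule parcs_cyclic_haar_sym)

  \<comment> \<open>By sign alone, vertices of equal sign are not adjacent and vertices of opposite
    sign share no neighbour; \<open>W\<close> and \<open>B\<close> settle the other cases.\<close>
  have disjoint: "\<forall>u\<in>\<Sigma>. \<forall>v\<in>\<Sigma>. u \<noteq> v \<longrightarrow> v \<notin> N u \<and> N u \<inter> N v = {}"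
    unfolding \<Sigma>_def by (simp add: N_plus N_minus)
  have "independent_set (graph_square H) \<Sigma>"
    unfolding independent_set_def
  proof (intro conjI ballI)
    show "\<Sigma> \<subseteq> pverts (graph_square H)"
      using pverts_H by (auto simp: \<Sigma>_def graph_square_def)
    fix u v
    assume uv: "u \<in> \<Sigma>" "v \<in> \<Sigma>"
    show "(u, v) \<notin> parcs (graph_square H)"
    proof
      assume "(u, v) \<in> parcs (graph_square H)"
      then have "u \<noteq> v" and "graph_dist H u v \<le> 2"
        by (simp_all add: graph_square_def)
      then have "v \<in> N u \<or> N u \<inter> N v \<noteq> {}"
        using graph_dist_le_2D[of u v] sym_H by (auto simp: N_def)
      with uv \<open>u \<noteq> v\<close> disjoint show False
        by blast
    qed
  qed
  moreover have "disconnected (with_proj H \<restriction> (pverts H - \<Sigma>))"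
  proof -
    define C where "C = {p b, p (b - a), p (2*b - a), m b, m (2*b), m (2*b - a)}"
    \<comment> \<open>Each hexagon vertex has two neighbours on the hexagon; its third lies in
      \<Sigma>.\<close>
    have closed: "N u \<subseteq> C \<union> \<Sigma>" if "u \<in> C" for u
      using that unfolding C_def \<Sigma>_def by (auto simp: N_plus N_minus)
    show ?thesis
    proof (rule disconnected_induce_subgraphI)
      show "p b \<in> C" by (simp add: C_def)
      show "p b \<in> pverts H - \<Sigma>" "p a \<in> pverts H - \<Sigma>" "p a \<notin> C"
        using pverts_H by (auto simp: \<Sigma>_def C_def)
      show "u \<in> C \<longleftrightarrow> v \<in> C"
        if "(u, v) \<in> parcs H" "u \<in> pverts H - \<Sigma>" "v \<in> pverts H - \<Sigma>" for u v
        \<comment> \<open>Symmetry of the arcs lets closedness at \<open>v\<close> give the converse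
          direction.\<close>
        using that closed[of u] closed[of v] sym_H by (auto simp: N_def)
    qed
  qed
  ultimately have "splitting_set H \<Sigma>"
    by (simp add: splitting_set_def)
  then show ?thesis
    unfolding \<Sigma>_eq splittable_def by blast
qed

end
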